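(* Let $(M,\mathcal{F},g)$ be a regular $B$-foliation with leaves of positive dimension on a compact $m$-dimensional Riemannian manifold with finite fundamental group and $m>2$, and for $\varepsilon>0$ let $\bar g^{\varepsilon}_{N(\varepsilon)}$ be the Riemannian metric on $M$ defined by $$\bar g^{\varepsilon}_{N(\varepsilon)}(X,Y)=g^{\varepsilon}_{N(\varepsilon)}(X^\perp,Y^\perp)+N(\varepsilon)\,g^{\varepsilon}_{N(\varepsilon)}(X^\perp,Y^\top)+N(\varepsilon)\,g^{\varepsilon}_{N(\varepsilon)}(X^\top,Y^\perp)+N(\varepsilon)^2\,g^{\varepsilon}_{N(\varepsilon)}(X^\top,Y^\top)$$ for vector fields $X,Y$ on $M$. Then the Riemannian metrics $\bar g^{\varepsilon}_{N(\varepsilon)}$ converge uniformly (i.e. in the $C^0$-topology) to $g$ as $\varepsilon\to 0$.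
   Context: A singular Riemannian foliation $(M,\mathcal{F},g)$ is a partition $\mathcal{F}$ of a Riemannian manifold $(M,g)$ into connected injectively immersed submanifolds (leaves) such that (i) there is a family of smooth vector fields on $M$ which at each $p\in M$ spans the tangent space $T_pL_p$ of the leaf $L_p$ through $p$; (ii) every geodesic perpendicular to the leaf through its starting point is perpendicular to every leaf it meets. It is regular if all leaves have the same dimension. A $B$-foliation is a singular Riemannian foliation whose leaves are closed aspherical submanifolds which are flat in the induced metric. For $v\in T_qM$ write $v=v^\top+v^\perp$ for the $g$-orthogonal decomposition with $v^\top\in T_qL_q$. For $n\in\mathbb{N}$ put $g_n(v,w)=n^{-2}g(v^\top,w^\top)+g(v^\perp,w^\perp)$; there are constants $\lambda\leq\Lambda$ with $\lambda\leq\mathrm{Sec}(g_n)\leq\Lambda$ for all $n$. A pure $\mathsf{N}$-structure on $M$ is a fibration $\tilde\eta\colon F(M)\to B$ of the $\mathrm{O}(m)$-frame bundle $\pi\colon F(M)\to M$ whose fibers are nilmanifolds $N/\Gamma$ ($N$ simply-connected nilpotent, with the canonical connection making left-invariant fields parallel), whose structure group lies in the affine automorphisms of the fiber, and such that the $\mathrm{O}(m)$-action preserves the fibers and the structure group. Its orbits are the $\pi$-images of the fibers; it has positive rank if the orbits have positive dimension. A metric on $M$ is $\tilde\eta$-invariant if the local sections of the associated sheaf of Lie algebras on $F(M)$ (restricting to local right-invariant fields on the fibers) project under $\pi$ to local Killing fields. For each $\varepsilon>0$ fix a pure $\mathsf{N}$-structure $\tilde\eta_\varepsilon$ on $M$ of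 positive rank and $N(\varepsilon)\in\mathbb{N}$ such that for all $n\geq N(\varepsilon)$ there is an $\tilde\eta_\varepsilon$-invariant Riemannian metric $g_n^\varepsilon$ on $M$ with $e^{-\varepsilon}g_n<g_n^\varepsilon<e^{\varepsilon}g_n$ and $\lambda-\varepsilon\leq\mathrm{Sec}(g_n^\varepsilon)\leq\Lambda+\varepsilon$. The metric $g^\varepsilon_{N(\varepsilon)}$ is the one with $n=N(\varepsilon)$. *)

theory Defs
  imports "HOL-Analysis.Analysis" "HOL-Algebra.Coset" "HOL-Algebra.Generated_Groups"
    "HOL-Library.Function_Algebras"
begin

section \<open>Smooth functions on open subsets of R^n\<close>

text \<open>
  The dimensions of leaves, of the base of a fibration and of a nilpotent group vary, so the
  dimension of a manifold is a natural number and the model space is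
  \<^const>\<open>Euclidean_space\<close> n, whose points are the sequences vanishing from index n on.
\<close>

definition partial :: "nat \<Rightarrow> ((nat \<Rightarrow> real) \<Rightarrow> real) \<Rightarrow> (nat \<Rightarrow> real) \<Rightarrow> real" where
  "partial i f x = deriv (\<lambda>t. f (x(i := t))) (x i)"

primrec Ck_fun :: "nat \<Rightarrow> nat \<Rightarrow> (nat \<Rightarrow> real) set \<Rightarrow> ((nat \<Rightarrow> real) \<Rightarrow> real) \<Rightarrow> bool" where
  "Ck_fun 0 n U f \<longleftrightarrow> continuous_map (subtopology (Euclidean_space n) U) euclideanreal f"
| "Ck_fun (Suc k) n U f \<longleftrightarrow>
     continuous_map (subtopology (Euclidean_space n) U) euclideanreal f \<and>
     (\<forall>i<n. (\<forall>x\<in>U. (\<lambda>t. f (x(i := t))) differentiable (at (x i))) \<and> Ck_fun k n U (partial i f))"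

definition smooth_fun :: "nat \<Rightarrow> (nat \<Rightarrow> real) set \<Rightarrow> ((nat \<Rightarrow> real) \<Rightarrow> real) \<Rightarrow> bool" where
  "smooth_fun n U f \<longleftrightarrow> (\<forall>k. Ck_fun k n U f)"

section \<open>Smooth manifolds\<close>

type_synonym 'a chart = "'a set \<times> ('a \<Rightarrow> nat \<Rightarrow> real)"

record 'a mfd =
  mdim :: nat
  atlas :: "'a chart set"

definition points :: "'a mfd \<Rightarrow> 'a set" where
  "points M = \<Union> (fst ` atlas M)"

abbreviation cinv :: "'a chart \<Rightarrow> (nat \<Rightarrow> real) \<Rightarrow> 'a" where
  "cinv c \<equiv> inv_into (fst c) (snd c)"

definition mfd_open :: "'a mfd \<Rightarrow> 'a set \<Rightarrow> bool" where
  "mfd_open M W \<longleftrightarrow> W \<subseteq> points M \<and>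
     (\<forall>c\<in>atlas M. openin (Euclidean_space (mdim M)) (snd c ` (W \<inter> fst c)))"

definition mtop :: "'a mfd \<Rightarrow> 'a topology" where
  "mtop M = topology (mfd_open M)"

definition smooth_manifold :: "'a mfd \<Rightarrow> bool" where
  "smooth_manifold M \<longleftrightarrow>
     (\<forall>c\<in>atlas M. inj_on (snd c) (fst c) \<and>
        openin (Euclidean_space (mdim M)) (snd c ` fst c)) \<and>
     (\<forall>c\<in>atlas M. \<forall>d\<in>atlas M.
        openin (Euclidean_space (mdim M)) (snd c ` (fst c \<inter> fst d)) \<and>
        (\<forall>j<mdim M. smooth_fun (mdim M) (snd c ` (fst c \<inter> fst d)) (\<lambda>x. snd d (cinv c x) j))) \<and>
     Hausdorff_space (mtop M) \<and> second_countable (mtop M)"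

lemma istopology_mfd_open:
  assumes inj: "\<And>c. c \<in> atlas M \<Longrightarrow> inj_on (snd c) (fst c)"
  shows "istopology (mfd_open M)"
  unfolding istopology_def
proof (intro conjI allI impI)
  fix S T assume S: "mfd_open M S" and T: "mfd_open M T"
  have "openin (Euclidean_space (mdim M)) (snd c ` (S \<inter> T \<inter> fst c))" if c: "c \<in> atlas M" for c
  proof -
    have "snd c ` (S \<inter> T \<inter> fst c) = snd c ` (S \<inter> fst c) \<inter> snd c ` (T \<inter> fst c)"
      using inj[OF c] by (auto simp: inj_on_def)
    with S T c show ?thesis by (auto simp: mfd_open_def)
  qed
  with S show "mfd_open M (S \<inter> T)" by (auto simp: mfd_open_def)
next
  fix \<K> assume K: "\<forall>S\<in>\<K>. mfd_open M S"
  have "openin (Euclidean_space (mdim M)) (snd c ` (\<Union>\<K> \<inter> fst c))" if "c \<in> atlas M" for c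
  proof -
    have "snd c ` (\<Union>\<K> \<inter> fst c) = (\<Union>S\<in>\<K>. snd c ` (S \<inter> fst c))" by auto
    with K that show ?thesis by (auto simp: mfd_open_def)
  qed
  with K show "mfd_open M (\<Union>\<K>)" by (auto simp: mfd_open_def)
qed

lemma openin_mtop:
  assumes "smooth_manifold M"
  shows "openin (mtop M) W \<longleftrightarrow> mfd_open M W"
  using assms by (simp add: mtop_def smooth_manifold_def istopology_mfd_open)

lemma topspace_mtop:
  assumes "smooth_manifold M"
  shows "topspace (mtop M) = points M"
proof
  show "topspace (mtop M) \<subseteq> points M"
    using openin_mtop[OF assms] by (metis mfd_open_def openin_topspace)
  have "snd c ` (points M \<inter> fst c) = snd c ` fst c" if "c \<in> atlas M" for c
    using that by (auto simp: points_def)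
  then have "mfd_open M (points M)"
    using assms by (auto simp: mfd_open_def smooth_manifold_def)
  then show "points M \<subseteq> topspace (mtop M)"
    using openin_mtop[OF assms] openin_subset by metis
qed

definition smooth_map :: "'a mfd \<Rightarrow> 'b mfd \<Rightarrow> ('a \<Rightarrow> 'b) \<Rightarrow> bool" where
  "smooth_map M N f \<longleftrightarrow> continuous_map (mtop M) (mtop N) f \<and>
     (\<forall>c\<in>atlas M. \<forall>d\<in>atlas N. \<forall>j<mdim N.
        smooth_fun (mdim M) (snd c ` {p \<in> fst c. f p \<in> fst d}) (\<lambda>x. snd d (f (cinv c x)) j))"

definition diffeomorphism :: "'a mfd \<Rightarrow> 'b mfd \<Rightarrow> ('a \<Rightarrow> 'b) \<Rightarrow> bool" where
  "diffeomorphism M N f \<longleftrightarrow> bij_betw f (points M) (points N) \<and>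
     smooth_map M N f \<and> smooth_map N M (inv_into (points M) f)"

definition open_submfd :: "'a mfd \<Rightarrow> 'a set \<Rightarrow> 'a mfd" where
  "open_submfd M W = \<lparr>mdim = mdim M, atlas = (\<lambda>c. (fst c \<inter> W, snd c)) ` atlas M\<rparr>"

definition prod_mfd :: "'a mfd \<Rightarrow> 'b mfd \<Rightarrow> ('a \<times> 'b) mfd" where
  "prod_mfd M N = \<lparr>mdim = mdim M + mdim N,
     atlas = (\<lambda>(c, d). (fst c \<times> fst d,
        \<lambda>(p, q) i. if i < mdim M then snd c p i else snd d q (i - mdim M))) ` (atlas M \<times> atlas N)\<rparr>"

section \<open>Tangent vectors and differentials\<close>

text \<open>
  A tangent vector at p is the family of its coordinate vectors in all charts around p; the entries
  of charts not containing p are set to 0.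
\<close>

type_synonym 'a tvec = "'a chart \<Rightarrow> nat \<Rightarrow> real"

definition tscale :: "real \<Rightarrow> 'a tvec \<Rightarrow> 'a tvec" where
  "tscale a v = (\<lambda>c i. a * v c i)"

global_interpretation tvec: vector_space tscale
  by unfold_locales (auto simp: tscale_def fun_eq_iff algebra_simps)

definition tspace :: "'a mfd \<Rightarrow> 'a \<Rightarrow> 'a tvec set" where
  "tspace M p = {v. \<forall>c.
     if c \<in> atlas M \<and> p \<in> fst c
     then v c \<in> topspace (Euclidean_space (mdim M)) \<and>
       (\<forall>d\<in>atlas M. p \<in> fst d \<longrightarrow> (\<forall>j<mdim M.
          v d j = (\<Sum>i<mdim M. partial i (\<lambda>x. snd d (cinv c x) j) (snd c p) * v c i)))
     else v c = 0}"

definition chart_at :: "'a mfd \<Rightarrow> 'a \<Rightarrow> 'a chart" where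
  "chart_at M p = (SOME c. c \<in> atlas M \<and> p \<in> fst c)"

text \<open>The differential of f at p; by the chain rule the choice of the chart around p is irrelevant.\<close>

definition tmap :: "'a mfd \<Rightarrow> 'b mfd \<Rightarrow> ('a \<Rightarrow> 'b) \<Rightarrow> 'a \<Rightarrow> 'a tvec \<Rightarrow> 'b tvec" where
  "tmap M N f p v = (let c = chart_at M p in
     (\<lambda>d j. if d \<in> atlas N \<and> f p \<in> fst d \<and> j < mdim N
        then \<Sum>i<mdim M. partial i (\<lambda>x. snd d (f (cinv c x)) j) (snd c p) * v c i
        else 0))"

definition coord_vec :: "'a mfd \<Rightarrow> 'a chart \<Rightarrow> nat \<Rightarrow> 'a \<Rightarrow> 'a tvec" where
  "coord_vec M c i p = (\<lambda>d j. if d \<in> atlas M \<and> p \<in> fst d \<and> j < mdim M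
     then partial i (\<lambda>x. snd d (cinv c x) j) (snd c p) else 0)"

definition velocity :: "'a mfd \<Rightarrow> (real \<Rightarrow> 'a) \<Rightarrow> real \<Rightarrow> 'a tvec" where
  "velocity M \<gamma> t = (\<lambda>c i. if c \<in> atlas M \<and> \<gamma> t \<in> fst c \<and> i < mdim M
     then deriv (\<lambda>s. snd c (\<gamma> s) i) t else 0)"

definition smooth_vfield :: "'a mfd \<Rightarrow> 'a set \<Rightarrow> ('a \<Rightarrow> 'a tvec) \<Rightarrow> bool" where
  "smooth_vfield M W X \<longleftrightarrow> openin (mtop M) W \<and> (\<forall>p\<in>W. X p \<in> tspace M p) \<and>
     (\<forall>c\<in>atlas M. \<forall>i<mdim M.
        smooth_fun (mdim M) (snd c ` (fst c \<inter> W)) (\<lambda>x. X (cinv c x) c i))"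

section \<open>Embedded submanifolds\<close>

text \<open>
  The d-dimensional manifold structure induced by M on a subset S: its charts are the inverses of
  all local parametrizations of S, i.e. of all immersions into M of open subsets of R^d that are
  homeomorphisms onto relatively open subsets of S.
\<close>

definition submfd :: "'a mfd \<Rightarrow> 'a set \<Rightarrow> nat \<Rightarrow> 'a mfd" where
  "submfd M S d = \<lparr>mdim = d, atlas = {c.
     openin (subtopology (mtop M) S) (fst c) \<and>
     openin (Euclidean_space d) (snd c ` fst c) \<and>
     homeomorphic_map (subtopology (mtop M) (fst c))
       (subtopology (Euclidean_space d) (snd c ` fst c)) (snd c) \<and>
     (\<forall>b\<in>atlas M.
        (\<forall>j<mdim M. smooth_fun d (snd c ` (fst c \<inter> fst b)) (\<lambda>x. snd b (cinv c x) j)) \<and>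
        (\<forall>p\<in>fst c \<inter> fst b. \<forall>r::nat \<Rightarrow> real.
           (\<forall>j<mdim M. (\<Sum>i<d. r i * partial i (\<lambda>x. snd b (cinv c x) j) (snd c p)) = 0)
           \<longrightarrow> (\<forall>i<d. r i = 0)))}\<rparr>"

definition embedded_submanifold :: "'a mfd \<Rightarrow> 'a set \<Rightarrow> nat \<Rightarrow> bool" where
  "embedded_submanifold M S d \<longleftrightarrow> S \<subseteq> points M \<and> points (submfd M S d) = S"

section \<open>Riemannian metrics\<close>

type_synonym 'a metric = "'a \<Rightarrow> 'a tvec \<Rightarrow> 'a tvec \<Rightarrow> real"

definition gmat :: "'a mfd \<Rightarrow> 'a metric \<Rightarrow> 'a chart \<Rightarrow> nat \<Rightarrow> nat \<Rightarrow> (nat \<Rightarrow> real) \<Rightarrow> real" where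
  "gmat M g c i j x = g (cinv c x) (coord_vec M c i (cinv c x)) (coord_vec M c j (cinv c x))"

definition riemannian_metric :: "'a mfd \<Rightarrow> 'a metric \<Rightarrow> bool" where
  "riemannian_metric M g \<longleftrightarrow>
     (\<forall>p\<in>points M. \<forall>u\<in>tspace M p. \<forall>v\<in>tspace M p.
        g p u v = g p v u \<and>
        (\<forall>w\<in>tspace M p. g p (u + v) w = g p u w + g p v w) \<and>
        (\<forall>a. g p (tscale a u) v = a * g p u v) \<and>
        (u \<noteq> 0 \<longrightarrow> g p u u > 0)) \<and>
     (\<forall>c\<in>atlas M. \<forall>i<mdim M. \<forall>j<mdim M. smooth_fun (mdim M) (snd c ` fst c) (gmat M g c i j))"

definition inv_mat :: "nat \<Rightarrow> (nat \<Rightarrow> nat \<Rightarrow> real) \<Rightarrow> nat \<Rightarrow> nat \<Rightarrow> real" where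
  "inv_mat n A = (SOME B. \<forall>i<n. \<forall>j<n. (\<Sum>k<n. A i k * B k j) = (if i = j then 1 else 0))"

text \<open>The Christoffel symbol of the Levi-Civita connection with upper index k and lower indices i, j.\<close>

definition christoffel ::
    "'a mfd \<Rightarrow> 'a metric \<Rightarrow> 'a chart \<Rightarrow> nat \<Rightarrow> nat \<Rightarrow> nat \<Rightarrow> (nat \<Rightarrow> real) \<Rightarrow> real" where
  "christoffel M g c k i j x =
     (\<Sum>l<mdim M. inv_mat (mdim M) (\<lambda>a b. gmat M g c a b x) k l *
        (partial i (gmat M g c j l) x + partial j (gmat M g c i l) x - partial l (gmat M g c i j) x) / 2)"

text \<open>The l-th coefficient of R(d_i, d_j) d_k, where R(X,Y)Z = D_X D_Y Z - D_Y D_X Z - D_[X,Y] Z.\<close>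

definition riem ::
    "'a mfd \<Rightarrow> 'a metric \<Rightarrow> 'a chart \<Rightarrow> nat \<Rightarrow> nat \<Rightarrow> nat \<Rightarrow> nat \<Rightarrow> (nat \<Rightarrow> real) \<Rightarrow> real" where
  "riem M g c l i j k x =
     partial i (christoffel M g c l j k) x - partial j (christoffel M g c l i k) x +
     (\<Sum>q<mdim M. christoffel M g c q j k x * christoffel M g c l i q x -
                  christoffel M g c q i k x * christoffel M g c l j q x)"

text \<open>The numerator is g(R(v,w)w, v).\<close>

definition sec :: "'a mfd \<Rightarrow> 'a metric \<Rightarrow> 'a \<Rightarrow> 'a tvec \<Rightarrow> 'a tvec \<Rightarrow> real" where
  "sec M g p v w = (let c = chart_at M p; x = snd c p; n = mdim M in
     (\<Sum>i<n. \<Sum>j<n. \<Sum>k<n. \<Sum>l<n. \<Sum>q<n.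
        riem M g c l i j k x * gmat M g c l q x * v c i * w c j * w c k * v c q)
     / (g p v v * g p w w - (g p v w)\<^sup>2))"

definition sec_bounds :: "'a mfd \<Rightarrow> 'a metric \<Rightarrow> real \<Rightarrow> real \<Rightarrow> bool" where
  "sec_bounds M g a b \<longleftrightarrow>
     (\<forall>p\<in>points M. \<forall>v\<in>tspace M p. \<forall>w\<in>tspace M p.
        g p v v * g p w w - (g p v w)\<^sup>2 \<noteq> 0 \<longrightarrow> a \<le> sec M g p v w \<and> sec M g p v w \<le> b)"

definition flat_metric :: "'a mfd \<Rightarrow> 'a metric \<Rightarrow> bool" where
  "flat_metric M g \<longleftrightarrow>
     (\<forall>c\<in>atlas M. \<forall>x\<in>snd c ` fst c. \<forall>l<mdim M. \<forall>i<mdim M. \<forall>j<mdim M. \<forall>k<mdim M.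
        riem M g c l i j k x = 0)"

definition geodesic :: "'a mfd \<Rightarrow> 'a metric \<Rightarrow> real \<Rightarrow> real \<Rightarrow> (real \<Rightarrow> 'a) \<Rightarrow> bool" where
  "geodesic M g a b \<gamma> \<longleftrightarrow>
     continuous_map (top_of_set {a<..<b}) (mtop M) \<gamma> \<and>
     (\<forall>t\<in>{a<..<b}. \<forall>c\<in>atlas M. \<gamma> t \<in> fst c \<longrightarrow> (\<forall>k<mdim M.
        (\<lambda>s. snd c (\<gamma> s) k) differentiable (at t) \<and>
        deriv (\<lambda>s. snd c (\<gamma> s) k) differentiable (at t) \<and>
        deriv (deriv (\<lambda>s. snd c (\<gamma> s) k)) t +
          (\<Sum>i<mdim M. \<Sum>j<mdim M. christoffel M g c k i j (snd c (\<gamma> t)) *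
             deriv (\<lambda>s. snd c (\<gamma> s) i) t * deriv (\<lambda>s. snd c (\<gamma> s) j) t) = 0))"

text \<open>The second condition is the vanishing of the Lie derivative of g along X, in coordinates.\<close>

definition killing_field :: "'a mfd \<Rightarrow> 'a metric \<Rightarrow> 'a set \<Rightarrow> ('a \<Rightarrow> 'a tvec) \<Rightarrow> bool" where
  "killing_field M g W X \<longleftrightarrow> smooth_vfield M W X \<and>
     (\<forall>c\<in>atlas M. \<forall>x\<in>snd c ` (fst c \<inter> W). \<forall>i<mdim M. \<forall>j<mdim M.
        (\<Sum>k<mdim M. X (cinv c x) c k * partial k (gmat M g c i j) x
           + gmat M g c k j x * partial i (\<lambda>y. X (cinv c y) c k) x
           + gmat M g c i k x * partial j (\<lambda>y. X (cinv c y) c k) x) = 0)"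

section \<open>Homotopy groups\<close>

definition loops :: "'a topology \<Rightarrow> 'a \<Rightarrow> (real \<Rightarrow> 'a) set" where
  "loops X p = {f. continuous_map (top_of_set {0..1}) X f \<and> f 0 = p \<and> f 1 = p}"

definition loop_homotopic :: "'a topology \<Rightarrow> 'a \<Rightarrow> ((real \<Rightarrow> 'a) \<times> (real \<Rightarrow> 'a)) set" where
  "loop_homotopic X p = {(f, h). f \<in> loops X p \<and> h \<in> loops X p \<and>
     homotopic_with (\<lambda>k. k 0 = p \<and> k 1 = p) (top_of_set {0..1}) X f h}"

definition fundamental_group :: "'a topology \<Rightarrow> 'a \<Rightarrow> (real \<Rightarrow> 'a) set set" where
  "fundamental_group X p = loops X p // loop_homotopic X p"

definition simply_connected_top :: "'a topology \<Rightarrow> bool" where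
  "simply_connected_top X \<longleftrightarrow> path_connected_space X \<and>
     (\<forall>p\<in>topspace X. \<forall>f\<in>loops X p. (f, \<lambda>_. p) \<in> loop_homotopic X p)"

text \<open>All homotopy groups of degree at least 2 vanish, at every base point.\<close>

definition aspherical :: "'a topology \<Rightarrow> bool" where
  "aspherical X \<longleftrightarrow>
     (\<forall>k\<ge>2. \<forall>b\<in>topspace (nsphere k). \<forall>f. continuous_map (nsphere k) X f \<longrightarrow>
        homotopic_with (\<lambda>h. h b = f b) (nsphere k) X f (\<lambda>_. f b))"

section \<open>Singular Riemannian foliations\<close>

text \<open>
  A foliation is given as the set of its leaves, each leaf carrying its own (leaf) topology and
  smooth structure.
\<close>

definition injectively_immersed :: "'a mfd \<Rightarrow> 'a mfd \<Rightarrow> bool" where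
  "injectively_immersed M L \<longleftrightarrow> smooth_manifold L \<and> points L \<subseteq> points M \<and>
     smooth_map L M (\<lambda>p. p) \<and>
     (\<forall>p\<in>points L. inj_on (tmap L M (\<lambda>p. p) p) (tspace L p))"

definition leaf_at :: "'a mfd set \<Rightarrow> 'a \<Rightarrow> 'a mfd" where
  "leaf_at F p = (THE L. L \<in> F \<and> p \<in> points L)"

definition leaf_tangent :: "'a mfd \<Rightarrow> 'a mfd set \<Rightarrow> 'a \<Rightarrow> 'a tvec set" where
  "leaf_tangent M F p = tmap (leaf_at F p) M (\<lambda>p. p) p ` tspace (leaf_at F p) p"

definition perpendicular_to_leaf ::
    "'a mfd \<Rightarrow> 'a mfd set \<Rightarrow> 'a metric \<Rightarrow> (real \<Rightarrow> 'a) \<Rightarrow> real \<Rightarrow> bool" where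
  "perpendicular_to_leaf M F g \<gamma> t \<longleftrightarrow>
     (\<forall>u\<in>leaf_tangent M F (\<gamma> t). g (\<gamma> t) (velocity M \<gamma> t) u = 0)"

definition singular_riemannian_foliation :: "'a mfd \<Rightarrow> 'a mfd set \<Rightarrow> 'a metric \<Rightarrow> bool" where
  "singular_riemannian_foliation M F g \<longleftrightarrow>
     smooth_manifold M \<and> riemannian_metric M g \<and>
     (\<forall>L\<in>F. points L \<noteq> {} \<and> connected_space (mtop L) \<and> injectively_immersed M L) \<and>
     (\<forall>p\<in>points M. \<exists>!L. L \<in> F \<and> p \<in> points L) \<and>
     (\<exists>\<X>. (\<forall>X\<in>\<X>. smooth_vfield M (points M) X) \<and>
        (\<forall>p\<in>points M. tvec.span ((\<lambda>X. X p) ` \<X>) = leaf_tangent M F p)) \<and>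
     (\<forall>\<gamma> a b s t. geodesic M g a b \<gamma> \<and> a < s \<and> s \<le> t \<and> t < b \<and>
        perpendicular_to_leaf M F g \<gamma> s \<longrightarrow> perpendicular_to_leaf M F g \<gamma> t)"

definition regular_foliation :: "'a mfd set \<Rightarrow> bool" where
  "regular_foliation F \<longleftrightarrow> (\<forall>L\<in>F. \<forall>L'\<in>F. mdim L = mdim L')"

definition induced_metric :: "'a mfd \<Rightarrow> 'a mfd \<Rightarrow> 'a metric \<Rightarrow> 'a metric" where
  "induced_metric M L g = (\<lambda>p v w. g p (tmap L M (\<lambda>p. p) p v) (tmap L M (\<lambda>p. p) p w))"

text \<open>Closed manifold means compact (manifolds here have no boundary).\<close>

definition B_foliation :: "'a mfd \<Rightarrow> 'a mfd set \<Rightarrow> 'a metric \<Rightarrow> bool" where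
  "B_foliation M F g \<longleftrightarrow> singular_riemannian_foliation M F g \<and>
     (\<forall>L\<in>F. compact_space (mtop L) \<and> aspherical (mtop L) \<and> flat_metric L (induced_metric M L g))"

definition tang :: "'a mfd \<Rightarrow> 'a mfd set \<Rightarrow> 'a metric \<Rightarrow> 'a \<Rightarrow> 'a tvec \<Rightarrow> 'a tvec" where
  "tang M F g q v = (THE u. u \<in> leaf_tangent M F q \<and> (\<forall>w\<in>leaf_tangent M F q. g q (v - u) w = 0))"

definition perp :: "'a mfd \<Rightarrow> 'a mfd set \<Rightarrow> 'a metric \<Rightarrow> 'a \<Rightarrow> 'a tvec \<Rightarrow> 'a tvec" where
  "perp M F g q v = v - tang M F g q v"

definition shrunk_metric :: "'a mfd \<Rightarrow> 'a mfd set \<Rightarrow> 'a metric \<Rightarrow> nat \<Rightarrow> 'a metric" where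
  "shrunk_metric M F g n = (\<lambda>q v w.
     g q (tang M F g q v) (tang M F g q w) / (real n)\<^sup>2 + g q (perp M F g q v) (perp M F g q w))"

text \<open>The splitting used to rescale h is the one orthogonal for g.\<close>

definition rescaled_metric :: "'a mfd \<Rightarrow> 'a mfd set \<Rightarrow> 'a metric \<Rightarrow> nat \<Rightarrow> 'a metric \<Rightarrow> 'a metric" where
  "rescaled_metric M F g n h = (\<lambda>q v w.
     h q (perp M F g q v) (perp M F g q w)
     + real n * h q (perp M F g q v) (tang M F g q w)
     + real n * h q (tang M F g q v) (perp M F g q w)
     + (real n)\<^sup>2 * h q (tang M F g q v) (tang M F g q w))"

definition metric_less :: "'a mfd \<Rightarrow> real \<Rightarrow> 'a metric \<Rightarrow> real \<Rightarrow> 'a metric \<Rightarrow> bool" where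
  "metric_less M a g b h \<longleftrightarrow>
     (\<forall>p\<in>points M. \<forall>v\<in>tspace M p. v \<noteq> 0 \<longrightarrow> a * g p v v < b * h p v v)"

text \<open>
  Uniform convergence of symmetric 2-tensors, measured by the operator norm with respect to g. On a
  compact manifold this is convergence in the C^0-topology, whatever the reference metric g.
\<close>

definition C0_converges ::
    "'a mfd \<Rightarrow> 'a metric \<Rightarrow> (real \<Rightarrow> 'a metric) \<Rightarrow> 'a metric \<Rightarrow> real filter \<Rightarrow> bool" where
  "C0_converges M g h k \<F> \<longleftrightarrow>
     uniform_limit {(p, v, w). p \<in> points M \<and> v \<in> tspace M p \<and> w \<in> tspace M p \<and>
                                g p v v \<le> 1 \<and> g p w w \<le> 1}
       (\<lambda>\<epsilon> (p, v, w). h \<epsilon> p v w) (\<lambda>(p, v, w). k p v w) \<F>"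

section \<open>The orthonormal frame bundle\<close>

text \<open>
  A frame at p is (p, e), with frame vectors e 0, ..., e (n - 1); beyond that e is 0 so that frames
  are determined by their vectors. The coordinates of a linear frame are those of p followed by the
  n * n coordinates of the frame vectors.
\<close>

type_synonym 'a frame = "'a \<times> (nat \<Rightarrow> 'a tvec)"

definition frame_dom :: "'a mfd \<Rightarrow> 'a chart \<Rightarrow> 'a frame set" where
  "frame_dom M c = {(p, e). p \<in> fst c \<and> (\<forall>i<mdim M. e i \<in> tspace M p) \<and> (\<forall>i\<ge>mdim M. e i = 0) \<and>
     (\<forall>r. (\<Sum>i<mdim M. tscale (r i) (e i)) = 0 \<longrightarrow> (\<forall>i<mdim M. r i = 0))}"

definition frame_coord :: "nat \<Rightarrow> 'a chart \<Rightarrow> 'a frame \<Rightarrow> nat \<Rightarrow> real" where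
  "frame_coord n c = (\<lambda>(p, e) k.
     if k < n then snd c p k
     else if k < n + n * n then e ((k - n) div n) c ((k - n) mod n)
     else 0)"

definition linear_frame_bundle :: "'a mfd \<Rightarrow> 'a frame mfd" where
  "linear_frame_bundle M = \<lparr>mdim = mdim M + mdim M * mdim M,
     atlas = (\<lambda>c. (frame_dom M c, frame_coord (mdim M) c)) ` atlas M\<rparr>"

definition frame_bundle :: "'a mfd \<Rightarrow> 'a metric \<Rightarrow> 'a frame mfd" where
  "frame_bundle M g = submfd (linear_frame_bundle M)
     {(p, e). (p, e) \<in> points (linear_frame_bundle M) \<and>
        (\<forall>i<mdim M. \<forall>j<mdim M. g p (e i) (e j) = (if i = j then 1 else 0))}
     (mdim M + mdim M * (mdim M - 1) div 2)"

definition orthogonal_mat :: "nat \<Rightarrow> (nat \<Rightarrow> nat \<Rightarrow> real) \<Rightarrow> bool" where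
  "orthogonal_mat n A \<longleftrightarrow>
     (\<forall>i<n. \<forall>j<n. (\<Sum>k<n. A k i * A k j) = (if i = j then 1 else 0))"

definition frame_act :: "nat \<Rightarrow> 'a frame \<Rightarrow> (nat \<Rightarrow> nat \<Rightarrow> real) \<Rightarrow> 'a frame" where
  "frame_act n x A = (fst x, \<lambda>j. if j < n then \<Sum>i<n. tscale (A i j) (snd x i) else 0)"

section \<open>Nilmanifolds\<close>

definition lie_group :: "'n monoid \<Rightarrow> 'n mfd \<Rightarrow> bool" where
  "lie_group G N \<longleftrightarrow> group G \<and> smooth_manifold N \<and> points N = carrier G \<and>
     smooth_map (prod_mfd N N) N (\<lambda>(a, b). a \<otimes>\<^bsub>G\<^esub> b) \<and> smooth_map N N (\<lambda>a. inv\<^bsub>G\<^esub> a)"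

primrec lower_central :: "'n monoid \<Rightarrow> nat \<Rightarrow> 'n set" where
  "lower_central G 0 = carrier G"
| "lower_central G (Suc k) = generate G
     {a \<otimes>\<^bsub>G\<^esub> b \<otimes>\<^bsub>G\<^esub> inv\<^bsub>G\<^esub> a \<otimes>\<^bsub>G\<^esub> inv\<^bsub>G\<^esub> b | a b. a \<in> carrier G \<and> b \<in> lower_central G k}"

definition nilpotent_group :: "'n monoid \<Rightarrow> bool" where
  "nilpotent_group G \<longleftrightarrow> (\<exists>k. lower_central G k = {\<one>\<^bsub>G\<^esub>})"

text \<open>
  Left-invariant fields, hence the canonical connection, descend to the quotient of N by left
  multiplications with elements of Gam. So the points of the nilmanifold are the right cosets
  Gam a. Its charts are those of N restricted to open sets on which the projection is injective.
\<close>

definition nilmanifold :: "'n monoid \<Rightarrow> 'n mfd \<Rightarrow> 'n set \<Rightarrow> 'n set mfd" where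
  "nilmanifold G N Gam = \<lparr>mdim = mdim N,
     atlas = {(r_coset G Gam ` W, \<lambda>z. \<phi> (inv_into W (r_coset G Gam) z)) | W U \<phi>.
        (U, \<phi>) \<in> atlas N \<and> openin (mtop N) W \<and> W \<subseteq> U \<and> inj_on (r_coset G Gam) W}\<rparr>"

definition nilmanifold_data :: "'n monoid \<Rightarrow> 'n mfd \<Rightarrow> 'n set \<Rightarrow> bool" where
  "nilmanifold_data G N Gam \<longleftrightarrow>
     lie_group G N \<and> simply_connected_top (mtop N) \<and> nilpotent_group G \<and>
     subgroup Gam G \<and> subtopology (mtop N) Gam = discrete_topology Gam \<and>
     compact_space (mtop (nilmanifold G N Gam))"

definition left_invariant :: "'n monoid \<Rightarrow> 'n mfd \<Rightarrow> ('n \<Rightarrow> 'n tvec) \<Rightarrow> bool" where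
  "left_invariant G N X \<longleftrightarrow> smooth_vfield N (points N) X \<and>
     (\<forall>a\<in>carrier G. \<forall>b\<in>carrier G. tmap N N (\<lambda>x. a \<otimes>\<^bsub>G\<^esub> x) b (X b) = X (a \<otimes>\<^bsub>G\<^esub> b))"

definition right_invariant :: "'n monoid \<Rightarrow> 'n mfd \<Rightarrow> ('n \<Rightarrow> 'n tvec) \<Rightarrow> bool" where
  "right_invariant G N X \<longleftrightarrow> smooth_vfield N (points N) X \<and>
     (\<forall>a\<in>carrier G. \<forall>b\<in>carrier G. tmap N N (\<lambda>x. x \<otimes>\<^bsub>G\<^esub> a) b (X b) = X (b \<otimes>\<^bsub>G\<^esub> a))"

text \<open>
  The canonical connection of the nilmanifold is the one whose (globally defined) parallel fields
  are the projections of the left-invariant fields of N; as these trivialize the tangent bundle,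
  a diffeomorphism is affine iff it maps such fields to such fields.
\<close>

definition parallel_field :: "'n monoid \<Rightarrow> 'n mfd \<Rightarrow> 'n set \<Rightarrow> ('n set \<Rightarrow> 'n set tvec) \<Rightarrow> bool" where
  "parallel_field G N Gam Y \<longleftrightarrow> (\<exists>X. left_invariant G N X \<and>
     (\<forall>a\<in>carrier G. tmap N (nilmanifold G N Gam) (r_coset G Gam) a (X a) = Y (r_coset G Gam a)))"

definition affine_automorphism :: "'n monoid \<Rightarrow> 'n mfd \<Rightarrow> 'n set \<Rightarrow> ('n set \<Rightarrow> 'n set) \<Rightarrow> bool" where
  "affine_automorphism G N Gam f \<longleftrightarrow> (let Z = nilmanifold G N Gam in
     diffeomorphism Z Z f \<and>
     (\<forall>Y. parallel_field G N Gam Y \<longrightarrow>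
        (\<exists>Y'. parallel_field G N Gam Y' \<and> (\<forall>z\<in>points Z. tmap Z Z f z (Y z) = Y' (f z)))))"

section \<open>Pure N-structures\<close>

text \<open>
  The O(m)-frame bundle is that of g; the orthonormal frame bundles of two metrics on M are
  O(m)-equivariantly diffeomorphic over M, so the choice of the metric does not matter.
  A pure N-structure consists of the base, the fibration, the nilpotent Lie group (as an abstract
  group and as a manifold), the lattice, and a bundle atlas. An element (U, Phi) of the bundle atlas
  stands for the trivialization x |-> (fibration x, Phi x) of the fibration over U.
\<close>

record ('a, 'b, 'n) nstruct =
  base :: "'b mfd"
  fibration :: "'a frame \<Rightarrow> 'b"
  nil_group :: "'n monoid"
  nil_mfd :: "'n mfd"
  lattice :: "'n set"
  trivs :: "('b set \<times> ('a frame \<Rightarrow> 'n set)) set"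

definition fiber_model :: "('a, 'b, 'n) nstruct \<Rightarrow> 'n set mfd" where
  "fiber_model E = nilmanifold (nil_group E) (nil_mfd E) (lattice E)"

definition fiber_affine :: "('a, 'b, 'n) nstruct \<Rightarrow> ('n set \<Rightarrow> 'n set) \<Rightarrow> bool" where
  "fiber_affine E = affine_automorphism (nil_group E) (nil_mfd E) (lattice E)"

text \<open>
  That the O(m)-action preserves the structure group means that, in the trivializations, each
  orthogonal matrix maps each fiber to a fiber by an affine map.
\<close>

definition pure_N_structure :: "'a mfd \<Rightarrow> 'a metric \<Rightarrow> ('a, 'b, 'n) nstruct \<Rightarrow> bool" where
  "pure_N_structure M g E \<longleftrightarrow> (let FM = frame_bundle M g; \<eta> = fibration E; B = base E in
     smooth_manifold B \<and>
     nilmanifold_data (nil_group E) (nil_mfd E) (lattice E) \<and>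
     smooth_map FM B \<eta> \<and>
     \<Union> (fst ` trivs E) = points B \<and>
     (\<forall>(U, \<Phi>)\<in>trivs E. openin (mtop B) U \<and>
        diffeomorphism (open_submfd FM {x \<in> points FM. \<eta> x \<in> U})
          (prod_mfd (open_submfd B U) (fiber_model E)) (\<lambda>x. (\<eta> x, \<Phi> x))) \<and>
     (\<forall>(U, \<Phi>)\<in>trivs E. \<forall>(V, \<Psi>)\<in>trivs E. \<forall>b\<in>U \<inter> V.
        \<exists>f. fiber_affine E f \<and> (\<forall>x\<in>points FM. \<eta> x = b \<longrightarrow> \<Psi> x = f (\<Phi> x))) \<and>
     (\<forall>A. orthogonal_mat (mdim M) A \<longrightarrow>
        (\<forall>x\<in>points FM. \<forall>y\<in>points FM.
           \<eta> x = \<eta> y \<longrightarrow> \<eta> (frame_act (mdim M) x A) = \<eta> (frame_act (mdim M) y A)) \<and>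
        (\<forall>(U, \<Phi>)\<in>trivs E. \<forall>(V, \<Psi>)\<in>trivs E. \<forall>b\<in>U.
           \<exists>f. fiber_affine E f \<and>
             (\<forall>x\<in>points FM. \<eta> x = b \<and> \<eta> (frame_act (mdim M) x A) \<in> V \<longrightarrow>
                \<Psi> (frame_act (mdim M) x A) = f (\<Phi> x)))))"

definition orbits :: "'a mfd \<Rightarrow> 'a metric \<Rightarrow> ('a, 'b, 'n) nstruct \<Rightarrow> 'a set set" where
  "orbits M g E =
     (\<lambda>b. fst ` {x \<in> points (frame_bundle M g). fibration E x = b}) ` points (base E)"

definition positive_rank :: "'a mfd \<Rightarrow> 'a metric \<Rightarrow> ('a, 'b, 'n) nstruct \<Rightarrow> bool" where
  "positive_rank M g E \<longleftrightarrow> (\<forall>Q\<in>orbits M g E. \<exists>d>0. embedded_submanifold M Q d)"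

text \<open>
  V is a section over S of the sheaf of Lie algebras on the frame bundle: locally, in a
  trivialization over U, it is a right-invariant field on the fiber not depending on the base
  point. As affine automorphisms map local right-invariant fields to such fields and the identity
  component of the affine group acts trivially on them, this does not depend on the trivialization.
\<close>

definition sheaf_section ::
    "'a mfd \<Rightarrow> 'a metric \<Rightarrow> ('a, 'b, 'n) nstruct \<Rightarrow> 'a frame set \<Rightarrow> ('a frame \<Rightarrow> 'a frame tvec) \<Rightarrow> bool"
    where
  "sheaf_section M g E S V \<longleftrightarrow>
    (let FM = frame_bundle M g; Z = fiber_model E; N = nil_mfd E;
         q = r_coset (nil_group E) (lattice E) in
     smooth_vfield FM S V \<and>
     (\<forall>x\<in>S. tmap FM (base E) (fibration E) x (V x) = 0) \<and>
     (\<forall>x\<in>S. \<exists>(U, \<Phi>)\<in>trivs E. \<exists>W W' X.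
        openin (mtop FM) W \<and> x \<in> W \<and> W \<subseteq> S \<and> fibration E ` W \<subseteq> U \<and>
        openin (mtop N) W' \<and> inj_on q W' \<and> \<Phi> ` W \<subseteq> q ` W' \<and>
        right_invariant (nil_group E) N X \<and>
        (\<forall>y\<in>W. \<forall>a\<in>W'. \<Phi> y = q a \<longrightarrow> tmap FM Z \<Phi> y (V y) = tmap N Z q a (X a))))"

definition invariant_metric :: "'a mfd \<Rightarrow> 'a metric \<Rightarrow> ('a, 'b, 'n) nstruct \<Rightarrow> 'a metric \<Rightarrow> bool" where
  "invariant_metric M g E h \<longleftrightarrow> (let FM = frame_bundle M g in
     \<forall>S V. sheaf_section M g E S V \<longrightarrow>
       (\<forall>x\<in>S. \<exists>W X. openin (mtop FM) W \<and> x \<in> W \<and> W \<subseteq> S \<and> killing_field M h (fst ` W) X \<and>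
          (\<forall>y\<in>W. tmap FM M fst y (V y) = X (fst y))))"

end

(* The linear map A v = perp v + n tang v pulls the shrunk metric g_n back to g and h to its rescaling.
   Hence h being pinched between exp(-eps) g_n and exp(eps) g_n pinches the rescaled quadratic form
   between exp(-eps) g and exp(eps) g, and polarization bounds the difference of the bilinear forms
   on the unit ball by exp(eps) - 1. *)
theory Submission
  imports Defs
begin

section \<open>Inner products and orthogonal projections on a subspace of tangent vectors\<close>

locale inner_product_on =
  fixes V :: "'a tvec set" and b :: "'a tvec \<Rightarrow> 'a tvec \<Rightarrow> real"
  assumes subspace: "tvec.subspace V"
    and sym: "\<And>u v. u \<in> V \<Longrightarrow> v \<in> V \<Longrightarrow> b u v = b v u"
    and add_left: "\<And>u v w. u \<in> V \<Longrightarrow> v \<in> V \<Longrightarrow> w \<in> V \<Longrightarrow> b (u + v) w = b u w + b v w"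
    and scale_left: "\<And>a u v. u \<in> V \<Longrightarrow> v \<in> V \<Longrightarrow> b (tscale a u) v = a * b u v"
    and pos: "\<And>u. u \<in> V \<Longrightarrow> u \<noteq> 0 \<Longrightarrow> b u u > 0"
begin

lemmas closed [simp] = tvec.subspace_0[OF subspace] tvec.subspace_add[OF subspace]
  tvec.subspace_diff[OF subspace] tvec.subspace_scale[OF subspace]

lemma add_right: "u \<in> V \<Longrightarrow> v \<in> V \<Longrightarrow> w \<in> V \<Longrightarrow> b w (u + v) = b w u + b w v"
  using add_left[of u v w] sym[of w] by simp

lemma scale_right: "u \<in> V \<Longrightarrow> v \<in> V \<Longrightarrow> b v (tscale a u) = a * b v u"
  using scale_left[of u v a] sym[of v] by simp

lemma diff_left: "u \<in> V \<Longrightarrow> v \<in> V \<Longrightarrow> w \<in> V \<Longrightarrow> b (u - v) w = b u w - b v w"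
  using add_left[of "u - v" v w] by simp

lemma diff_right: "u \<in> V \<Longrightarrow> v \<in> V \<Longrightarrow> w \<in> V \<Longrightarrow> b w (u - v) = b w u - b w v"
  using add_right[of "u - v" v w] by simp

lemma zero_left: "w \<in> V \<Longrightarrow> b 0 w = 0"
  using diff_left[of 0 0 w] by simp

lemma zero_right: "w \<in> V \<Longrightarrow> b w 0 = 0"
  using diff_right[of 0 0 w] by simp

lemmas bilinear = add_left add_right scale_left scale_right diff_left diff_right

lemma polarization:
  assumes "v \<in> V" "w \<in> V"
  shows "4 * b v w = b (v + w) (v + w) - b (v - w) (v - w)"
  using assms sym[of v w] by (simp add: bilinear)

text \<open>Polarization leaves error terms at v + w and v - w; this identity turns their sum back
  into the quadratic form at v and w alone.\<close>

lemma parallelogram: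
  assumes "v \<in> V" "w \<in> V"
  shows "b (v + w) (v + w) + b (v - w) (v - w) = 2 * (b v v + b w w)"
  using assms sym[of v w] by (simp add: bilinear)

text \<open>The difference of two candidates lies in S and is orthogonal to S, hence to itself, so
  positivity makes it vanish.\<close>

lemma orthogonal_projection_unique:
  assumes S: "tvec.subspace S" "S \<subseteq> V" and v: "v \<in> V"
    and u: "u \<in> S" "\<And>w. w \<in> S \<Longrightarrow> b (v - u) w = 0"
    and u': "u' \<in> S" "\<And>w. w \<in> S \<Longrightarrow> b (v - u') w = 0"
  shows "u = u'"
proof (rule ccontr)
  assume "u \<noteq> u'"
  have d: "u - u' \<in> S" using S u u' by (simp add: tvec.subspace_diff)
  have "b (u - u') (u - u') = b (v - u') (u - u') - b (v - u) (u - u')"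
    using S v u(1) u'(1) by (auto simp: bilinear subset_iff)
  also have "\<dots> = 0" using d u u' by simp
  finally show False using pos[of "u - u'"] d S \<open>u \<noteq> u'\<close> by auto
qed

text \<open>
  Induction on the number k of coordinates that may be nonzero: the last one cuts out a subspace of
  codimension at most one, and a complement is straightened by the projection already available.
\<close>

lemma orthogonal_projection_exists_coord:
  assumes "tvec.subspace S" "S \<subseteq> V" "v \<in> V"
    and "\<And>s. s \<in> S \<Longrightarrow> (\<forall>i<k. s c i = 0) \<Longrightarrow> s = 0"
  shows "\<exists>u\<in>S. \<forall>w\<in>S. b (v - u) w = 0"
  using assms
proof (induction k arbitrary: S v)
  case 0
  \<comment> \<open>With k = 0 the coordinate condition is vacuous, so every element of S is forced
    to be 0.\<close>
  then have "S = {0}" using tvec.subspace_0 by fastforce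
  moreover have "b (v - 0) 0 = 0" using zero_right \<open>v \<in> V\<close> by fastforce
  ultimately show ?case by blast
next
  case (Suc k)
  note SV = \<open>S \<subseteq> V\<close> and sub = \<open>tvec.subspace S\<close>
  note S_closed = tvec.subspace_0[OF sub] tvec.subspace_add[OF sub] tvec.subspace_diff[OF sub]
    tvec.subspace_scale[OF sub]
  define S0 where "S0 = {s \<in> S. s c k = 0}"
  have sub0: "tvec.subspace S0"
    using S_closed by (intro tvec.subspaceI) (simp_all add: S0_def tscale_def)
  have IH: "\<exists>u\<in>S0. \<forall>w\<in>S0. b (x - u) w = 0" if "x \<in> V" for x
  proof (rule Suc.IH[OF sub0])
    show "S0 \<subseteq> V" using SV by (auto simp: S0_def)
    show "s = 0" if "s \<in> S0" "\<forall>i<k. s c i = 0" for s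
      using that by (intro Suc.prems(4)) (auto simp: S0_def less_Suc_eq)
  qed fact
  show ?case
  proof (cases "S0 = S")
    case True
    then show ?thesis using IH[OF \<open>v \<in> V\<close>] by metis
  next
    case False
    then obtain u where u: "u \<in> S" "u c k \<noteq> 0" by (auto simp: S0_def)
    then obtain pu where pu: "pu \<in> S0" "\<And>w. w \<in> S0 \<Longrightarrow> b (u - pu) w = 0"
      using IH[of u] SV by blast
    obtain pv where pv: "pv \<in> S0" "\<And>w. w \<in> S0 \<Longrightarrow> b (v - pv) w = 0"
      using IH[OF \<open>v \<in> V\<close>] by blast
    \<comment> \<open>Removing the projection of u onto \<open>S0\<close> makes e orthogonal to
      \<open>S0\<close> without changing its k-th coordinate, which stays nonzero.\<close>
    define e where "e = u - pu"
    have e: "e \<in> S" "e c k \<noteq> 0" using u pu S_closed by (auto simp: e_def S0_def)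
    have eS0: "b e w = 0" if "w \<in> S0" for w using pu that by (simp add: e_def)
    have eV: "e \<in> V" and pvS: "pv \<in> S" "pv \<in> V" using e pv SV by (auto simp: S0_def)
    have "e \<noteq> 0" using e(2) by (metis zero_fun_apply)
    then have ee: "b e e > 0" by (rule pos[OF eV])
    \<comment> \<open>The Fourier coefficient along e: subtracting \<open>tscale r e\<close> makes
      the remainder orthogonal to e, while orthogonality to \<open>S0\<close> persists because e is
      orthogonal to \<open>S0\<close>.\<close>
    define r where "r = b (v - pv) e / b e e"
    let ?u = "pv + tscale r e"
    have "b (v - ?u) w = 0" if w: "w \<in> S" for w
    proof -
      \<comment> \<open>This multiple of e cancels the k-th coordinate of w, which splits w into an
        element of \<open>S0\<close> and a multiple of e.\<close>
      define t where "t = w c k / e c k"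
      define w0 where "w0 = w - tscale t e"
      have "w0 \<in> S" using w e(1) S_closed(3,4) by (simp add: w0_def)
      moreover have "w0 c k = 0" using e(2) by (simp add: w0_def t_def tscale_def)
      ultimately have w0: "w0 \<in> S0" by (simp add: S0_def)
      then have w0V: "w0 \<in> V" using SV by (auto simp: S0_def)
      have "b (v - ?u) w = b (v - pv - tscale r e) (w0 + tscale t e)"
        by (simp add: w0_def algebra_simps)
      also have "\<dots> = b (v - pv) w0 - r * b e w0 + t * (b (v - pv) e - r * b e e)"
        using w0V eV pvS \<open>v \<in> V\<close> by (simp add: bilinear algebra_simps)
      also have "\<dots> = 0" using pv(2)[OF w0] eS0[OF w0] ee by (simp add: r_def)
      finally show ?thesis .
    qed
    moreover have "?u \<in> S" using pvS e S_closed by auto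
    ultimately show ?thesis by blast
  qed
qed

end

section \<open>Tangent spaces as inner product spaces\<close>

text \<open>Points of \<open>Euclidean_space n\<close> vanish from index n on, so this condition
  merges with the default value 0 in charts away from p. Membership can then be checked entry by
  entry.\<close>

lemma tspace_iff:
  "v \<in> tspace M p \<longleftrightarrow>
     (\<forall>c i. \<not> (c \<in> atlas M \<and> p \<in> fst c \<and> i < mdim M) \<longrightarrow> v c i = 0) \<and>
     (\<forall>c d j. c \<in> atlas M \<and> p \<in> fst c \<and> d \<in> atlas M \<and> p \<in> fst d \<and> j < mdim M \<longrightarrow>
        v d j = (\<Sum>i<mdim M. partial i (\<lambda>x. snd d (cinv c x) j) (snd c p) * v c i))"
  unfolding tspace_def mem_Collect_eq if_bool_eq_conj topspace_Euclidean_space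
    fun_eq_iff zero_fun_apply
  by (meson linorder_not_less)

lemma subspace_tspace: "tvec.subspace (tspace M p)"
proof (rule tvec.subspaceI)
  show "0 \<in> tspace M p" unfolding tspace_iff by simp
next
  fix v w assume v: "v \<in> tspace M p" and w: "w \<in> tspace M p"
  show "v + w \<in> tspace M p"
    unfolding tspace_iff plus_fun_apply
  proof (intro conjI allI impI)
    fix c d j
    assume *: "c \<in> atlas M \<and> p \<in> fst c \<and> d \<in> atlas M \<and> p \<in> fst d \<and> j < mdim M"
    show "v d j + w d j =
      (\<Sum>i<mdim M. partial i (\<lambda>x. snd d (cinv c x) j) (snd c p) * (v c i + w c i))"
      unfolding distrib_left sum.distrib
      using v[unfolded tspace_iff] w[unfolded tspace_iff] * by (intro arg_cong2[where f = "(+)"]) blast+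
  next
    fix c i
    assume "\<not> (c \<in> atlas M \<and> p \<in> fst c \<and> i < mdim M)"
    then have "v c i = 0" "w c i = 0"
      using v[unfolded tspace_iff] w[unfolded tspace_iff] by blast+
    then show "v c i + w c i = 0" by simp
  qed
next
  fix a v assume v: "v \<in> tspace M p"
  show "tscale a v \<in> tspace M p"
    unfolding tspace_iff tscale_def
  proof (intro conjI allI impI)
    fix c d j
    assume *: "c \<in> atlas M \<and> p \<in> fst c \<and> d \<in> atlas M \<and> p \<in> fst d \<and> j < mdim M"
    then have "v d j = (\<Sum>i<mdim M. partial i (\<lambda>x. snd d (cinv c x) j) (snd c p) * v c i)"
      using v[unfolded tspace_iff] by blast
    then show "a * v d j =
      (\<Sum>i<mdim M. partial i (\<lambda>x. snd d (cinv c x) j) (snd c p) * (a * v c i))"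
      by (simp only: sum_distrib_left mult.left_commute)
  next
    fix c i
    assume "\<not> (c \<in> atlas M \<and> p \<in> fst c \<and> i < mdim M)"
    then have "v c i = 0"
      using v[unfolded tspace_iff] by blast
    then show "a * v c i = 0" by simp
  qed
qed

text \<open>The transition formula computes the entries in every chart from those in one. This is
  the finite-dimensionality that the existence of projections relies on.\<close>

lemma tspace_eq_0:
  assumes "c \<in> atlas M" "p \<in> fst c" "v \<in> tspace M p" "\<forall>i<mdim M. v c i = 0"
  shows "v = 0"
proof (intro ext)
  fix d j
  note v = assms(3)[unfolded tspace_iff]
  show "v d j = 0 d j"
  proof (cases "d \<in> atlas M \<and> p \<in> fst d \<and> j < mdim M")
    case True
    then have "v d j = (\<Sum>i<mdim M. partial i (\<lambda>x. snd d (cinv c x) j) (snd c p) * v c i)"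
      using v assms(1,2) by blast
    then show ?thesis using assms(4) by simp
  next
    case False
    then have "v d j = 0" using v by blast
    then show ?thesis by simp
  qed
qed

text \<open>Stated for an arbitrary metric, since it is applied both to \<open>g\<close> and to the
  metrics compared with it.\<close>

lemma riemannian_metric_inner_product_on:
  assumes "riemannian_metric M g" "p \<in> points M"
  shows "inner_product_on (tspace M p) (g p)"
proof -
  note * = assms(1)[unfolded riemannian_metric_def, THEN conjunct1, rule_format, OF assms(2)]
  show ?thesis
  proof
    fix a u v w
    assume u: "u \<in> tspace M p" and v: "v \<in> tspace M p"
    show "g p u v = g p v u" by (rule *[OF u v, THEN conjunct1])
    show "g p (tscale a u) v = a * g p u v"
      by (rule *[OF u v, THEN conjunct2, THEN conjunct2, THEN conjunct1, rule_format])
    show "g p (u + v) w = g p u w + g p v w" if "w \<in> tspace M p"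
      by (rule *[OF u v, THEN conjunct2, THEN conjunct1, rule_format, OF that])
  next
    fix u assume u: "u \<in> tspace M p" "u \<noteq> 0"
    show "g p u u > 0"
      by (rule *[OF u(1,1), THEN conjunct2, THEN conjunct2, THEN conjunct2, rule_format, OF u(2)])
  qed (rule subspace_tspace)
qed

section \<open>The orthogonal splitting along the leaf through a point\<close>

locale foliated_point =
  fixes M :: "'a mfd" and F :: "'a mfd set" and g :: "'a metric" and p :: 'a
  assumes foliation: "singular_riemannian_foliation M F g" and point: "p \<in> points M"
begin

lemma metric: "riemannian_metric M g"
  using foliation by (simp add: singular_riemannian_foliation_def)

sublocale inner_product_on "tspace M p" "g p"
  by (rule riemannian_metric_inner_product_on[OF metric point])

text \<open>The smooth fields of the foliation span the leaf directions: a span is a subspace, and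
  the values of these fields are tangent to M.\<close>

lemma leaf_tangent_subspace: "tvec.subspace (leaf_tangent M F p)"
  and leaf_tangent_subset: "leaf_tangent M F p \<subseteq> tspace M p"
proof -
  obtain \<X> where X: "\<And>X. X \<in> \<X> \<Longrightarrow> smooth_vfield M (points M) X"
    and "\<And>p. p \<in> points M \<Longrightarrow> tvec.span ((\<lambda>X. X p) ` \<X>) = leaf_tangent M F p"
    using foliation[unfolded singular_riemannian_foliation_def, THEN conjunct2, THEN conjunct2,
        THEN conjunct2, THEN conjunct2, THEN conjunct1] by metis
  then have span: "tvec.span ((\<lambda>X. X p) ` \<X>) = leaf_tangent M F p"
    using point by simp
  show "tvec.subspace (leaf_tangent M F p)"
    using tvec.subspace_span unfolding span[symmetric] .
  have "(\<lambda>X. X p) ` \<X> \<subseteq> tspace M p"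
    using X point unfolding smooth_vfield_def by blast
  then show "leaf_tangent M F p \<subseteq> tspace M p"
    unfolding span[symmetric] by (rule tvec.span_minimal[OF _ subspace_tspace])
qed

text \<open>\<open>tang\<close> is a definite description; uniqueness of the projection allows its
  value to be read off from any suitable vector.\<close>

lemma tang_unique:
  assumes "v \<in> tspace M p" "u \<in> leaf_tangent M F p" "\<And>w. w \<in> leaf_tangent M F p \<Longrightarrow> g p (v - u) w = 0"
  shows "tang M F g p v = u"
  unfolding tang_def
  using assms orthogonal_projection_unique[OF leaf_tangent_subspace leaf_tangent_subset assms(1)]
  by (intro the_equality) blast+

text \<open>A chart around p provides \<open>mdim M\<close> coordinates that detect 0, so a
  projection exists, and by \<open>tang_unique\<close> it is the value of
  \<open>tang\<close>.\<close>

lemma tang_in_leaf_tangent: "v \<in> tspace M p \<Longrightarrow> tang M F g p v \<in> leaf_tangent M F p"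
  and perp_orthogonal:
    "v \<in> tspace M p \<Longrightarrow> w \<in> leaf_tangent M F p \<Longrightarrow> g p (perp M F g p v) w = 0"
proof -
  obtain c where c: "c \<in> atlas M" "p \<in> fst c" using point by (auto simp: points_def)
  have "\<exists>u\<in>leaf_tangent M F p. \<forall>w\<in>leaf_tangent M F p. g p (v - u) w = 0" if "v \<in> tspace M p" for v
    using leaf_tangent_subset tspace_eq_0[OF c]
    by (intro orthogonal_projection_exists_coord[OF leaf_tangent_subspace leaf_tangent_subset that,
          where k = "mdim M" and c = c]) blast
  then show "v \<in> tspace M p \<Longrightarrow> tang M F g p v \<in> leaf_tangent M F p"
    "v \<in> tspace M p \<Longrightarrow> w \<in> leaf_tangent M F p \<Longrightarrow> g p (perp M F g p v) w = 0"
    using tang_unique unfolding perp_def by metis+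
qed

lemma tang_closed [simp]: "v \<in> tspace M p \<Longrightarrow> tang M F g p v \<in> tspace M p"
  using tang_in_leaf_tangent leaf_tangent_subset by blast

lemma perp_closed [simp]: "v \<in> tspace M p \<Longrightarrow> perp M F g p v \<in> tspace M p"
  by (simp add: perp_def)

lemma tang_eqI:
  assumes "t \<in> leaf_tangent M F p" "u \<in> tspace M p" "\<And>w. w \<in> leaf_tangent M F p \<Longrightarrow> g p u w = 0"
  shows "tang M F g p (u + t) = t" "perp M F g p (u + t) = u"
proof -
  show "tang M F g p (u + t) = t"
    using assms leaf_tangent_subset by (intro tang_unique) auto
  then show "perp M F g p (u + t) = u" by (simp add: perp_def)
qed

section \<open>Stretching along the leaves and its effect on the metrics\<close>

definition stretch :: "real \<Rightarrow> 'a tvec \<Rightarrow> 'a tvec" where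
  "stretch a v = perp M F g p v + tscale a (tang M F g p v)"

lemma stretch_closed [simp]: "v \<in> tspace M p \<Longrightarrow> stretch a v \<in> tspace M p"
  by (simp add: stretch_def)

text \<open>The defining sum of \<open>stretch\<close> is already an orthogonal splitting, because
  leaf directions are closed under scaling; \<open>tang_eqI\<close> reads off its two parts.\<close>

lemma tang_stretch: "v \<in> tspace M p \<Longrightarrow> tang M F g p (stretch a v) = tscale a (tang M F g p v)"
  and perp_stretch: "v \<in> tspace M p \<Longrightarrow> perp M F g p (stretch a v) = perp M F g p v"
  unfolding stretch_def
  by (rule tang_eqI; simp add: tvec.subspace_scale[OF leaf_tangent_subspace] tang_in_leaf_tangent
      perp_orthogonal)+

lemma tang_add:
  assumes "v \<in> tspace M p" "w \<in> tspace M p"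
  shows "tang M F g p (v + w) = tang M F g p v + tang M F g p w"
proof (rule tang_unique)
  show "g p (v + w - (tang M F g p v + tang M F g p w)) x = 0" if "x \<in> leaf_tangent M F p" for x
  proof -
    have "v + w - (tang M F g p v + tang M F g p w) = perp M F g p v + perp M F g p w"
      by (simp add: perp_def)
    moreover have "x \<in> tspace M p" using that leaf_tangent_subset by blast
    ultimately show ?thesis using assms that by (simp add: add_left perp_orthogonal)
  qed
qed (use assms in \<open>simp_all add: tvec.subspace_add[OF leaf_tangent_subspace] tang_in_leaf_tangent\<close>)

lemma stretch_add:
  assumes "v \<in> tspace M p" "w \<in> tspace M p"
  shows "stretch a (v + w) = stretch a v + stretch a w"
  using assms by (simp add: stretch_def perp_def tang_add tvec.scale_right_distrib)

lemma stretch_diff: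
  assumes "v \<in> tspace M p" "w \<in> tspace M p"
  shows "stretch a (v - w) = stretch a v - stretch a w"
  using stretch_add[of "v - w" w a] assms by simp

text \<open>The factor \<open>n\<^sup>2\<close> produced by stretching cancels the shrinking, with n
  at least 1 excluding division by 0, and orthogonality removes the mixed terms of \<open>g\<close>.
  The diagonal suffices because \<open>metric_less\<close> compares quadratic forms.\<close>

lemma shrunk_metric_stretch:
  assumes "v \<in> tspace M p" "n \<ge> 1"
  shows "shrunk_metric M F g n p (stretch (real n) v) (stretch (real n) v) = g p v v"
proof -
  let ?t = "tang M F g p v" and ?u = "perp M F g p v"
  have "g p ?u ?t = 0" using assms by (simp add: perp_orthogonal tang_in_leaf_tangent)
  moreover have "g p v v = g p (?u + ?t) (?u + ?t)" by (simp add: perp_def)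
  ultimately have "g p v v = g p ?t ?t + g p ?u ?u"
    using assms sym[of ?u ?t] by (simp add: bilinear)
  then show ?thesis
    using assms by (simp add: shrunk_metric_def tang_stretch perp_stretch bilinear power2_eq_square)
qed

text \<open>The splitting is orthogonal for \<open>g\<close> but in general not for
  \<open>h\<close>, so the bilinear expansion keeps its mixed terms: these are the two terms with
  factor n.\<close>

lemma rescaled_metric_eq_stretch:
  assumes "riemannian_metric M h" "v \<in> tspace M p" "w \<in> tspace M p"
  shows "rescaled_metric M F g n h p v w = h p (stretch (real n) v) (stretch (real n) w)"
proof -
  interpret h: inner_product_on "tspace M p" "h p"
    by (rule riemannian_metric_inner_product_on[OF assms(1) point])
  show ?thesis
    using assms(2,3)
    by (simp add: rescaled_metric_def stretch_def h.bilinear power2_eq_square algebra_simps)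
qed

text \<open>The estimate is proved first on the diagonal, where the pinching applies to the
  stretched vector, and then polarized.\<close>

lemma rescaled_metric_bound:
  assumes h: "riemannian_metric M h" and n: "n \<ge> 1" and "\<epsilon> > 0"
    and lower: "metric_less M (exp (- \<epsilon>)) (shrunk_metric M F g n) 1 h"
    and upper: "metric_less M 1 h (exp \<epsilon>) (shrunk_metric M F g n)"
    and v: "v \<in> tspace M p" and w: "w \<in> tspace M p"
  shows "\<bar>rescaled_metric M F g n h p v w - g p v w\<bar> \<le> (exp \<epsilon> - 1) * ((g p v v + g p w w) / 2)"
proof -
  interpret h: inner_product_on "tspace M p" "h p"
    by (rule riemannian_metric_inner_product_on[OF h point])
  let ?A = "stretch (real n)"
  have diag: "\<bar>h p (?A x) (?A x) - g p x x\<bar> \<le> (exp \<epsilon> - 1) * g p x x" if x: "x \<in> tspace M p" for x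
  proof (cases "?A x = 0")
    \<comment> \<open>\<open>metric_less\<close> speaks of nonzero vectors only. Here the
      pulled-back form shows that \<open>g p x x\<close> is 0, so both sides of the estimate
      vanish.\<close>
    case True
    then have "g p x x = shrunk_metric M F g n p 0 0"
      using shrunk_metric_stretch[OF x n] by simp
    also have "\<dots> = 0"
      using tang_eqI[of 0 0] zero_left tvec.subspace_0[OF leaf_tangent_subspace] leaf_tangent_subset
      by (auto simp: shrunk_metric_def subset_iff)
    finally show ?thesis using True h.zero_left[of 0] by simp
  next
    case False
    have "exp (- \<epsilon>) * g p x x < h p (?A x) (?A x)" "h p (?A x) (?A x) < exp \<epsilon> * g p x x"
      using lower upper False x point unfolding metric_less_def
      by (metis stretch_closed shrunk_metric_stretch[OF x n] mult_1)+
    moreover have "g p x x \<ge> 0" using pos[OF x] zero_left[of 0] by (cases "x = 0") auto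
    \<comment> \<open>From \<open>exp (- \<epsilon>) \<ge> 1 - \<epsilon>\<close> and
      \<open>exp \<epsilon> \<ge> 1 + \<epsilon>\<close>: the deviation below 1 is at most the one
      above, so a single constant \<open>exp \<epsilon> - 1\<close> serves both sides.\<close>
    then have "(2 - exp \<epsilon>) * g p x x \<le> exp (- \<epsilon>) * g p x x"
      using exp_ge_add_one_self[of "- \<epsilon>"] exp_ge_add_one_self[of \<epsilon>]
      by (intro mult_right_mono) linarith+
    ultimately show ?thesis by (simp add: abs_le_iff algebra_simps)
  qed
  \<comment> \<open>Polarization for h at the stretched vectors minus polarization for g. Additivity
    of the stretch brings both terms into the diagonal form just estimated.\<close>
  have "4 * (h p (?A v) (?A w) - g p v w) =
      (h p (?A (v + w)) (?A (v + w)) - g p (v + w) (v + w)) -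
      (h p (?A (v - w)) (?A (v - w)) - g p (v - w) (v - w))"
    using h.polarization[of "?A v" "?A w"] polarization[OF v w] v w
    by (simp add: stretch_add stretch_diff)
  moreover have "v + w \<in> tspace M p" "v - w \<in> tspace M p" using v w by simp_all
  ultimately have "4 * \<bar>h p (?A v) (?A w) - g p v w\<bar> \<le>
      (exp \<epsilon> - 1) * g p (v + w) (v + w) + (exp \<epsilon> - 1) * g p (v - w) (v - w)"
    using diag[of "v + w"] diag[of "v - w"] by linarith
  also have "\<dots> = (exp \<epsilon> - 1) * (2 * (g p v v + g p w w))"
    by (simp only: distrib_left[symmetric] parallelogram[OF v w])
  also have "\<dots> = 4 * ((exp \<epsilon> - 1) * ((g p v v + g p w w) / 2))" by simp
  finally show ?thesis
    unfolding rescaled_metric_eq_stretch[OF h v w] by (rule mult_left_le_imp_le) simp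
qed

end

section \<open>Uniform convergence on the unit balls of the tangent spaces\<close>

theorem lemma3p3:
  fixes M :: "'a mfd" and F :: "'a mfd set" and g :: "'a metric" and m :: nat
    and lam Lam :: real
    and eta :: "real \<Rightarrow> ('a, 'b, 'n) nstruct"
    and N :: "real \<Rightarrow> nat"
    and ge :: "real \<Rightarrow> nat \<Rightarrow> 'a metric"
  assumes manifold: "smooth_manifold M" "riemannian_metric M g" "compact_space (mtop M)"
    and dim: "mdim M = m" "m > 2"
    and finite_pi1: "\<And>p. p \<in> points M \<Longrightarrow> finite (fundamental_group (mtop M) p)"
    and foliation: "B_foliation M F g" "regular_foliation F" "\<And>L. L \<in> F \<Longrightarrow> mdim L > 0"
    and lam_le: "lam \<le> Lam"
    and sec_shrunk: "\<And>n. n \<ge> 1 \<Longrightarrow> sec_bounds M (shrunk_metric M F g n) lam Lam"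
    and N_structure: "\<And>\<epsilon>. \<epsilon> > 0 \<Longrightarrow> pure_N_structure M g (eta \<epsilon>) \<and> positive_rank M g (eta \<epsilon>)"
    and N_pos: "\<And>\<epsilon>. \<epsilon> > 0 \<Longrightarrow> N \<epsilon> \<ge> 1"
    and ge: "\<And>\<epsilon> n. \<epsilon> > 0 \<Longrightarrow> n \<ge> N \<epsilon> \<Longrightarrow>
        riemannian_metric M (ge \<epsilon> n) \<and>
        invariant_metric M g (eta \<epsilon>) (ge \<epsilon> n) \<and>
        metric_less M (exp (- \<epsilon>)) (shrunk_metric M F g n) 1 (ge \<epsilon> n) \<and>
        metric_less M 1 (ge \<epsilon> n) (exp \<epsilon>) (shrunk_metric M F g n) \<and>
        sec_bounds M (ge \<epsilon> n) (lam - \<epsilon>) (Lam + \<epsilon>)"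
  shows "C0_converges M g (\<lambda>\<epsilon>. rescaled_metric M F g (N \<epsilon>) (ge \<epsilon> (N \<epsilon>))) g (at_right 0)"
proof -
  have srf: "singular_riemannian_foliation M F g"
    using foliation(1) by (simp add: B_foliation_def)
  have bound: "\<bar>rescaled_metric M F g (N \<epsilon>) (ge \<epsilon> (N \<epsilon>)) p v w - g p v w\<bar> \<le> exp \<epsilon> - 1"
    if eps: "\<epsilon> > 0" and p: "p \<in> points M" and vw: "v \<in> tspace M p" "w \<in> tspace M p"
      and le: "g p v v \<le> 1" "g p w w \<le> 1" for \<epsilon> p v w
  proof -
    interpret foliated_point M F g p
      using srf p by unfold_locales
    have "\<bar>rescaled_metric M F g (N \<epsilon>) (ge \<epsilon> (N \<epsilon>)) p v w - g p v w\<bar>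
        \<le> (exp \<epsilon> - 1) * ((g p v v + g p w w) / 2)"
      using ge[OF eps order_refl] N_pos[OF eps] eps vw by (intro rescaled_metric_bound) auto
    \<comment> \<open>Inside the unit ball the mean of the two quadratic terms is at most 1, so the
      bound depends neither on the point nor on the vectors. This gives uniformity.\<close>
    also have "\<dots> \<le> (exp \<epsilon> - 1) * 1"
      using le eps by (intro mult_left_mono) auto
    finally show ?thesis by simp
  qed
  have lim: "((\<lambda>\<epsilon>::real. exp \<epsilon> - 1) \<longlongrightarrow> 0) (at_right 0)"
    by (auto intro!: tendsto_eq_intros)
  show ?thesis
    unfolding C0_converges_def
  proof (rule uniform_limitI)
    fix e :: real
    assume "e > 0"
    then have "\<forall>\<^sub>F \<epsilon> in at_right 0. exp \<epsilon> - 1 < e"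
      by (rule order_tendstoD(2)[OF lim])
    then show "\<forall>\<^sub>F \<epsilon> in at_right 0. \<forall>x\<in>{(p, v, w). p \<in> points M \<and> v \<in> tspace M p \<and>
        w \<in> tspace M p \<and> g p v v \<le> 1 \<and> g p w w \<le> 1}.
        dist (case x of (p, v, w) \<Rightarrow> rescaled_metric M F g (N \<epsilon>) (ge \<epsilon> (N \<epsilon>)) p v w)
          (case x of (p, v, w) \<Rightarrow> g p v w) < e"
      \<comment> \<open>The filter \<open>at_right 0\<close> supplies \<open>\<epsilon> > 0\<close>,
        under which the bound was proved.\<close>
      using eventually_at_right_less[of "0::real"]
    proof eventually_elim
      case (elim \<epsilon>)
      then show ?case using bound[OF elim(2)] by (fastforce simp: dist_real_def)
    qed
  qed
qed

end
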